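(* Let $k,d\geq1$ be integers and let $f=(f_1,\dotsc,f_d)\colon\mathbb{R}^k\to\mathbb{R}^d$ be a real analytic map which is partially linear on $\mathbb{R}^k$, i.e. there are real numbers $b_1,\dotsc,b_d$, not all zero, such that $\sum_{i=1}^d b_if_i$ is an affine map $\mathbb{R}^k\to\mathbb{R}$. Then there is some self-similar measure $\mu$ on $\mathbb{R}^k$ which is not supported in any affine hyperplane in $\mathbb{R}^k$, and such that neither $\mu$ nor the pushforward $\mu_f$ is Rajchman.
   Context: Self-similar measure: let $N>1$ be an integer, $r_1,\dotsc,r_N\in(0,1)$, $O_1,\dotsc,O_N\in O_k(\mathbb{R})$ orthogonal matrices, $\mathbf{t}_1,\dotsc,\mathbf{t}_N\in\mathbb{R}^k$, $g_i(\mathbf{x})=r_iO_i\mathbf{x}+\mathbf{t}_i$, and $p_1,\dotsc,p_N\in(0,1)$ with $\sum_i p_i=1$. The associated self-similar measure is the unique Borel probability measure $\mu$ on $\mathbb{R}^k$ with $\mu=\sum_i p_i\,\mu_{g_i}$. It is always assumed that the maps $g_i$ do not share a common fixed point. Pushforward: $\mu_f(B)=\mu(f^{-1}(B))$ for Borel sets $B$. The Fourier transform of a finite Borel measure $\nu$ on $\mathbb{R}^d$ is $\widehat{\nu}(\boldsymbol{\xi})=\int e^{-2\pi i\langle\boldsymbol{\xi},\mathbf{x}\rangle}\,d\nu(\mathbf{x})$. The measure $\nu$ is Rajchman if $\widehat{\nu}(\boldsymbol{\xi})\to0$ as $|\boldsymbol{\xi}|\to\infty$, and non-Rajchman if $\limsup_{|\boldsymbol{\xi}|\to\infty}|\widehat{\nu}(\boldsymbol{\xi})|>0$.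 *)

theory Defs
  imports "HOL-Probability.Probability"
begin

(* Real analytic on all of R^k: near every point x0, f is the sum of a power series in
   x - x0, with multi-indices \<alpha> in N^k and coefficients in R^d. The relation has_sum is
   unordered (equivalently, absolute) summability over all multi-indices. *)
definition real_analytic :: "(real ^ 'k \<Rightarrow> real ^ 'd) \<Rightarrow> bool" where
  "real_analytic f \<longleftrightarrow>
     (\<forall>x0. \<exists>e>0. \<exists>c :: ('k \<Rightarrow> nat) \<Rightarrow> real ^ 'd. \<forall>x\<in>ball x0 e.
        ((\<lambda>\<alpha>. (\<Prod>j\<in>UNIV. (x $ j - x0 $ j) ^ \<alpha> j) *\<^sub>R c \<alpha>) has_sum f x) UNIV)"

definition partially_linear :: "(real ^ 'k \<Rightarrow> real ^ 'd) \<Rightarrow> bool" where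
  "partially_linear f \<longleftrightarrow>
     (\<exists>b :: 'd \<Rightarrow> real. (\<exists>i. b i \<noteq> 0) \<and>
        (\<exists>a c. \<forall>x. (\<Sum>i\<in>UNIV. b i * f x $ i) = a \<bullet> x + c))"

definition similarity_map :: "real \<Rightarrow> real ^ 'k ^ 'k \<Rightarrow> real ^ 'k \<Rightarrow> real ^ 'k \<Rightarrow> real ^ 'k" where
  "similarity_map r Q t x = r *\<^sub>R (Q *v x) + t"

(* The defining equation is \<mu> = \<Sum>i. p i * (push-forward of \<mu> under the i-th map); by
   Hutchinson's theorem it has exactly one Borel probability measure as solution, so
   characterising the self-similar measure by the equation involves no choice. *)
definition self_similar_measure :: "(real ^ 'k) measure \<Rightarrow> bool" where
  "self_similar_measure \<mu> \<longleftrightarrow>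
     prob_space \<mu> \<and> sets \<mu> = sets borel \<and>
     (\<exists>(N :: nat) r Q t p.
        N > 1 \<and>
        (\<forall>i<N. 0 < r i \<and> r i < 1 \<and> orthogonal_matrix (Q i) \<and> 0 < p i \<and> p i < 1) \<and>
        (\<Sum>i<N. p i) = 1 \<and>
        \<not> (\<exists>x. \<forall>i<N. similarity_map (r i) (Q i) (t i) x = x) \<and>
        (\<forall>B\<in>sets borel. measure \<mu> B =
           (\<Sum>i<N. p i * measure (distr \<mu> borel (similarity_map (r i) (Q i) (t i))) B)))"

definition affine_hyperplane :: "'a::euclidean_space set \<Rightarrow> bool" where
  "affine_hyperplane H \<longleftrightarrow> (\<exists>a b. a \<noteq> 0 \<and> H = {x. a \<bullet> x = b})"

definition supported_in :: "'a measure \<Rightarrow> 'a set \<Rightarrow> bool" where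
  "supported_in \<mu> A \<longleftrightarrow> (AE x in \<mu>. x \<in> A)"

definition fourier_transform :: "'a::euclidean_space measure \<Rightarrow> 'a \<Rightarrow> complex" where
  "fourier_transform \<nu> \<xi> = (\<integral>x. exp (- 2 * pi * \<i> * complex_of_real (\<xi> \<bullet> x)) \<partial>\<nu>)"

definition Rajchman :: "'a::euclidean_space measure \<Rightarrow> bool" where
  "Rajchman \<nu> \<longleftrightarrow> (fourier_transform \<nu> \<longlongrightarrow> 0) at_infinity"

end

theory Submission imports Defs
begin

text \<open>
  Let \<open>b \<bullet> f x = a \<bullet> x + c\<close>. At the frequency \<open>s b\<close> the transform of the push-forward has the same
  modulus as the transform of \<open>\<mu>\<close> at \<open>s a\<close>, so \<open>\<mu>\<close> only has to fail the Rajchman property along the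
  line spanned by \<open>a\<close> (any line, if \<open>a = 0\<close>). Take the maps \<open>x \<mapsto> x / 3 + t\<^sub>i\<close> with \<open>t\<^sub>0 = 0\<close>, the
  other \<open>t\<^sub>i\<close> a basis with all \<open>a \<bullet> t\<^sub>i\<close> integers, and \<open>p\<^sub>0 = 2 / 3\<close>. Stationarity says that the transform
  at \<open>\<xi>\<close> is \<open>\<phi> \<xi> = (\<Sum>i. p\<^sub>i exp (- 2 \<pi> \<i> \<xi> \<bullet> t\<^sub>i))\<close> times the transform at \<open>\<xi> / 3\<close>. Here \<open>\<phi> (3\<^sup>n a) = 1\<close>,
  so the transform is constant along \<open>3\<^sup>n a\<close>; and \<open>\<phi>\<close> never vanishes because \<open>p\<^sub>0 > 1 / 2\<close>, so neither
  does the transform, by its continuity at 0.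
\<close>

section \<open>Existence of homogeneous self-similar measures without rotations\<close>

text \<open>Stationarity is an identity between \<mu> and the law of a random map, with index drawn
  by \<open>p\<close>, at an independent point drawn by \<mu>. In this form Fubini turns it into an
  identity for integrals.\<close>

locale homothetic_measure = prob_space \<mu>
  for \<mu> :: "'a::euclidean_space measure" and N :: nat and r :: real and t :: "nat \<Rightarrow> 'a" and p :: "nat \<Rightarrow> real" +
  assumes sets_eq [measurable_cong]: "sets \<mu> = sets borel"
    and weight_nonneg: "\<And>i. i < N \<Longrightarrow> 0 \<le> p i"
    and weight_sum: "(\<Sum>i<N. p i) = 1"
    and stationary: "\<mu> = distr (point_measure {..<N} p \<Otimes>\<^sub>M \<mu>) borel (\<lambda>(i, x). r *\<^sub>R x + t i)"

lemma prob_space_point_measure_weights: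
  fixes p :: "nat \<Rightarrow> real"
  assumes "\<And>i. i < N \<Longrightarrow> 0 \<le> p i" "(\<Sum>i<N. p i) = 1"
  shows "prob_space (point_measure {..<N} p)"
proof (rule prob_space_point_measure)
  have "(\<Sum>i<N. ennreal (p i)) = ennreal (\<Sum>i<N. p i)"
    using assms by (intro sum_ennreal) auto
  then show "(\<Sum>i<N. ennreal (p i)) = 1" using assms by simp
qed auto

text \<open>The measure is the law of \<open>\<Sum>n. r\<^sup>n t\<^bsub>i(n)\<^esub>\<close> for independent indices \<open>i(n)\<close> distributed according to \<open>p\<close>.\<close>

lemma homothetic_measure_exists:
  fixes t :: "nat \<Rightarrow> 'a::euclidean_space" and p :: "nat \<Rightarrow> real"
  assumes r: "\<bar>r\<bar> < 1" and p: "\<And>i. i < N \<Longrightarrow> 0 \<le> p i" "(\<Sum>i<N. p i) = 1"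
  shows "\<exists>\<mu>. homothetic_measure \<mu> N r t p"
proof -
  define M where "M = point_measure {..<N} p"
  define u where "u i = (if i < N then t i else 0)" for i
  define S where "S \<omega> = (\<Sum>n. r ^ n *\<^sub>R u (\<omega> !! n))" for \<omega>
  interpret M: prob_space M
    unfolding M_def by (rule prob_space_point_measure_weights) (use p in auto)
  interpret P: prob_space "stream_space M" by (rule M.prob_space_stream_space)
  have [simp]: "space M = {..<N}" by (simp add: M_def space_point_measure)
  have [measurable]: "u \<in> borel_measurable M" "t \<in> borel_measurable M"
    by (auto simp: M_def measurable_point_measure_eq1)
  have S[measurable]: "S \<in> borel_measurable (stream_space M)"
    unfolding S_def by measurable
  define B where "B = (\<Sum>i<N. norm (t i))"
  have u_le: "norm (u i) \<le> B" for i
    unfolding u_def B_def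
    by (auto intro!: sum_nonneg member_le_sum[where f = "\<lambda>i. norm (t i)"])
  have summ: "summable (\<lambda>n. r ^ n *\<^sub>R u (\<omega> !! n))" for \<omega>
  proof (rule summable_comparison_test')
    show "summable (\<lambda>n. \<bar>r\<bar> ^ n * B)"
      using r by (intro summable_mult2 summable_geometric) auto
    show "norm (r ^ n *\<^sub>R u (\<omega> !! n)) \<le> \<bar>r\<bar> ^ n * B" if "n \<ge> 0" for n
      using u_le by (simp add: power_abs mult_left_mono)
  qed
  \<comment> \<open>Prepending a letter shifts the series by one power of \<open>r\<close>; this is
    the source of self-similarity.\<close>
  have S_Stream: "S (i ## \<omega>) = r *\<^sub>R S \<omega> + u i" for i \<omega>
    using suminf_split_head[OF summ, of "i ## \<omega>"] summ
    by (simp add: S_def suminf_scaleR_right algebra_simps)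
  define \<mu> where "\<mu> = distr (stream_space M) borel S"
  interpret \<mu>: prob_space \<mu>
    unfolding \<mu>_def by (rule P.prob_space_distr) measurable
  have [measurable_cong]: "sets \<mu> = sets borel" by (simp add: \<mu>_def)
  have "\<mu> = distr (M \<Otimes>\<^sub>M \<mu>) borel (\<lambda>(i, x). r *\<^sub>R x + t i)"
  proof (rule measure_eqI)
    fix A assume "A \<in> sets \<mu>"
    then have [measurable]: "A \<in> sets borel" by (simp add: \<mu>_def)
    have "emeasure \<mu> A = (\<integral>\<^sup>+x. indicator A x \<partial>\<mu>)" by simp
    also have "\<dots> = (\<integral>\<^sup>+\<omega>. indicator A (S \<omega>) \<partial>stream_space M)"
      unfolding \<mu>_def by (rule nn_integral_distr) auto
    \<comment> \<open>The first letter of the stream is split off; it is independent of the tail,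
      which has the law of the whole stream.\<close>
    also have "\<dots> = (\<integral>\<^sup>+i. \<integral>\<^sup>+\<omega>. indicator A (S (i ## \<omega>)) \<partial>stream_space M \<partial>M)"
      by (rule M.nn_integral_stream_space) measurable
    also have "\<dots> = (\<integral>\<^sup>+i. \<integral>\<^sup>+x. indicator A (r *\<^sub>R x + t i) \<partial>\<mu> \<partial>M)"
      by (intro nn_integral_cong) (simp add: \<mu>_def nn_integral_distr S_Stream u_def)
    also have "\<dots> = (\<integral>\<^sup>+z. indicator A (case z of (i, x) \<Rightarrow> r *\<^sub>R x + t i) \<partial>(M \<Otimes>\<^sub>M \<mu>))"
      by (subst \<mu>.nn_integral_fst[symmetric]) auto
    also have "\<dots> = emeasure (distr (M \<Otimes>\<^sub>M \<mu>) borel (\<lambda>(i, x). r *\<^sub>R x + t i)) A"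
      by (subst nn_integral_indicator[symmetric], simp, subst nn_integral_distr) auto
    finally show "emeasure \<mu> A = \<dots>" .
  qed (simp add: \<mu>_def)
  then show ?thesis
    unfolding M_def using p
    by (intro exI[of _ \<mu>] homothetic_measure.intro homothetic_measure_axioms.intro)
      (auto simp: \<mu>.prob_space_axioms \<open>sets \<mu> = sets borel\<close>)
qed

section \<open>Stationarity, Fourier transform and support\<close>

context homothetic_measure
begin

lemma space_eq [simp]: "space \<mu> = UNIV"
  using sets_eq_imp_space_eq[OF sets_eq] by simp

lemma integral_stationary:
  fixes g :: "'a \<Rightarrow> 'b::{banach,second_countable_topology}"
  assumes g[measurable]: "g \<in> borel_measurable borel" and B: "\<And>x. norm (g x) \<le> B"
  shows "(\<integral>x. g x \<partial>\<mu>) = (\<Sum>i<N. p i *\<^sub>R (\<integral>x. g (r *\<^sub>R x + t i) \<partial>\<mu>))"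
proof -
  let ?M = "point_measure {..<N} p"
  interpret M: prob_space ?M
    by (rule prob_space_point_measure_weights) (auto simp: weight_nonneg weight_sum)
  interpret P: pair_prob_space ?M \<mu> ..
  have [measurable]: "t \<in> borel_measurable ?M" by (simp add: measurable_point_measure_eq1)
  have "(\<integral>x. g x \<partial>\<mu>) = (\<integral>z. g (case z of (i, x) \<Rightarrow> r *\<^sub>R x + t i) \<partial>(?M \<Otimes>\<^sub>M \<mu>))"
    by (subst stationary, subst integral_distr) auto
  also have "\<dots> = (\<integral>i. \<integral>x. g (r *\<^sub>R x + t i) \<partial>\<mu> \<partial>?M)"
    using B by (subst P.integral_fst'[symmetric]) (auto intro!: P.integrable_const_bound[of _ B])
  also have "\<dots> = (\<Sum>i<N. p i *\<^sub>R (\<integral>x. g (r *\<^sub>R x + t i) \<partial>\<mu>))"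
    by (rule lebesgue_integral_point_measure_finite) (auto simp: weight_nonneg)
  finally show ?thesis .
qed

lemma measure_stationary:
  assumes [measurable]: "A \<in> sets borel"
  shows "measure \<mu> A = (\<Sum>i<N. p i * measure (distr \<mu> borel (\<lambda>x. r *\<^sub>R x + t i)) A)"
proof -
  have "measure (distr \<mu> borel (\<lambda>x. r *\<^sub>R x + t i)) A = (\<integral>x. indicator A (r *\<^sub>R x + t i) \<partial>\<mu>)" for i
    by (subst integral_distr[symmetric, where N = borel]) auto
  moreover have "measure \<mu> A = (\<integral>x. indicator A x \<partial>\<mu>)" by simp
  ultimately show ?thesis
    using integral_stationary[of "indicator A :: 'a \<Rightarrow> real" 1]
    by (simp add: indicator_def)
qed

text \<open>The exceptional set has measure 0, which is a sum of nonnegative weighted push-forward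
  measures; hence the term with \<open>p i > 0\<close> vanishes.\<close>

lemma AE_stationary:
  assumes ae: "AE x in \<mu>. P x" and [measurable]: "Measurable.pred borel P" and i: "i < N" "p i > 0"
  shows "AE x in \<mu>. P (r *\<^sub>R x + t i)"
proof -
  let ?A = "{x. \<not> P x}"
  have A[measurable]: "?A \<in> sets borel" by measurable
  have "measure \<mu> ?A = 0"
    using ae by (subst prob_eq_0) (auto simp: sets_eq)
  then have "(\<Sum>i<N. p i * measure (distr \<mu> borel (\<lambda>x. r *\<^sub>R x + t i)) ?A) = 0"
    using measure_stationary[OF A] by simp
  then have "p i * measure (distr \<mu> borel (\<lambda>x. r *\<^sub>R x + t i)) ?A = 0"
    using i(1) by (subst (asm) sum_nonneg_eq_0_iff) (auto simp: weight_nonneg simp del: mult_eq_0_iff)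
  then have "measure \<mu> {x. \<not> P (r *\<^sub>R x + t i)} = 0"
    using i by (simp add: measure_distr vimage_def)
  then show ?thesis
    by (subst (asm) prob_eq_0) auto
qed

text \<open>Characters are multiplicative, so each translation splits off as a phase, while the
  common scaling passes to the frequency.\<close>

lemma fourier_transform_stationary:
  "fourier_transform \<mu> \<xi> =
     (\<Sum>i<N. p i *\<^sub>R exp (- 2 * pi * \<i> * complex_of_real (\<xi> \<bullet> t i))) * fourier_transform \<mu> (r *\<^sub>R \<xi>)"
proof -
  let ?e = "\<lambda>\<xi> x. exp (- 2 * pi * \<i> * complex_of_real (\<xi> \<bullet> x))"
  have "?e \<xi> (r *\<^sub>R x + t i) = ?e \<xi> (t i) * ?e (r *\<^sub>R \<xi>) x" for x i
    unfolding exp_add[symmetric] by (simp add: inner_add_right ring_distribs add.commute)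
  moreover have "(\<integral>x. ?e \<xi> x \<partial>\<mu>) = (\<Sum>i<N. p i *\<^sub>R (\<integral>x. ?e \<xi> (r *\<^sub>R x + t i) \<partial>\<mu>))"
    by (rule integral_stationary[where B = 1]) auto
  ultimately show ?thesis
    by (simp only: fourier_transform_def sum_distrib_right integral_mult_right_zero mult_scaleR_left)
qed


lemma fourier_transform_0 [simp]: "fourier_transform \<mu> 0 = 1"
  using prob_space by (simp add: fourier_transform_def)

lemma fourier_transform_isCont_0: "isCont (fourier_transform \<mu>) 0"
  unfolding isCont_def tendsto_at_iff_sequentially o_def
proof safe
  fix X :: "nat \<Rightarrow> 'a" assume X: "X \<longlonglongrightarrow> 0"
  show "(\<lambda>n. fourier_transform \<mu> (X n)) \<longlonglongrightarrow> fourier_transform \<mu> 0"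
    unfolding fourier_transform_def
  proof (rule integral_dominated_convergence[where w = "\<lambda>_. 1"])
    have "(\<lambda>n. exp (- 2 * pi * \<i> * complex_of_real (X n \<bullet> x)))
        \<longlonglongrightarrow> exp (- 2 * pi * \<i> * complex_of_real (0 \<bullet> x))" for x
      by (intro tendsto_intros X)
    then show "AE x in \<mu>. (\<lambda>n. exp (- 2 * pi * \<i> * complex_of_real (X n \<bullet> x)))
        \<longlonglongrightarrow> exp (- 2 * pi * \<i> * complex_of_real (0 \<bullet> x))" by simp
  qed auto
qed

text \<open>A zero at \<xi> would propagate to all \<open>r ^ n *\<^sub>R \<xi>\<close>,
  contradicting continuity at 0, where the value is 1.\<close>

lemma fourier_transform_nonzero:
  assumes r: "\<bar>r\<bar> < 1" and i: "i < N" "t i = 0" "p i > 1 / 2"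
  shows "fourier_transform \<mu> \<xi> \<noteq> 0"
proof
  assume zero: "fourier_transform \<mu> \<xi> = 0"
  define \<phi> where "\<phi> \<eta> = (\<Sum>j<N. p j *\<^sub>R exp (- 2 * pi * \<i> * complex_of_real (\<eta> \<bullet> t j)))" for \<eta>
  \<comment> \<open>Since \<open>t i = 0\<close>, the i-th term is exactly
    \<open>p i > 1 / 2\<close>; the others have total modulus at most \<open>1 - p i\<close> and
    cannot cancel it.\<close>
  have \<phi>_nonzero: "\<phi> \<eta> \<noteq> 0" for \<eta>
  proof
    let ?s = "\<Sum>j\<in>{..<N}-{i}. p j *\<^sub>R exp (- 2 * pi * \<i> * complex_of_real (\<eta> \<bullet> t j))"
    assume "\<phi> \<eta> = 0"
    moreover have "\<phi> \<eta> = of_real (p i) + ?s"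
      unfolding \<phi>_def using i by (subst sum.remove[of _ i]) (auto simp: scaleR_conv_of_real)
    ultimately have "?s = - of_real (p i)"
      by (simp only: add_eq_0_iff)
    then have "norm ?s = p i"
      using i by (simp only: norm_minus_cancel norm_of_real)
    moreover have "norm ?s \<le> (\<Sum>j\<in>{..<N}-{i}. p j)"
      by (rule sum_norm_le) (auto simp: weight_nonneg)
    moreover have "p i + (\<Sum>j\<in>{..<N}-{i}. p j) = 1"
      using weight_sum i by (subst (asm) sum.remove[of _ i]) auto
    ultimately show False using i by simp
  qed
  have "fourier_transform \<mu> (r ^ n *\<^sub>R \<xi>) = 0" for n
  proof (induction n)
    case (Suc n)
    then show ?case
      using fourier_transform_stationary[of "r ^ n *\<^sub>R \<xi>"] \<phi>_nonzero[of "r ^ n *\<^sub>R \<xi>"]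
      by (simp add: \<phi>_def)
  qed (use zero in simp)
  moreover have "(\<lambda>n. r ^ n *\<^sub>R \<xi>) \<longlonglongrightarrow> 0"
    using tendsto_scaleR[OF LIMSEQ_abs_realpow_zero2[OF r] tendsto_const[of \<xi>]] by simp
  then have "(\<lambda>n. fourier_transform \<mu> (r ^ n *\<^sub>R \<xi>)) \<longlonglongrightarrow> fourier_transform \<mu> 0"
    by (rule isCont_tendsto_compose[OF fourier_transform_isCont_0])
  ultimately show False by (simp add: LIMSEQ_const_iff)
qed

text \<open>Integrality of \<open>1 / r\<close> keeps all the scaled pairings with the
  \<open>t i\<close> integral, so every phase is 1 and the multiplier is the total weight 1.\<close>

lemma fourier_transform_lattice:
  assumes r: "r \<noteq> 0" "1 / r \<in> \<int>" and lattice: "\<And>i. i < N \<Longrightarrow> \<xi> \<bullet> t i \<in> \<int>"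
  shows "fourier_transform \<mu> ((1 / r) ^ n *\<^sub>R \<xi>) = fourier_transform \<mu> \<xi>"
proof (induction n)
  case (Suc n)
  let ?\<eta> = "(1 / r) ^ Suc n *\<^sub>R \<xi>"
  have "exp (- 2 * pi * \<i> * complex_of_real (?\<eta> \<bullet> t i)) = 1" if "i < N" for i
  proof -
    have "?\<eta> \<bullet> t i \<in> \<int>"
      unfolding inner_scaleR_left by (intro Ints_mult Ints_power r lattice that)
    then obtain m :: int where "?\<eta> \<bullet> t i = of_int m" by (rule Ints_cases)
    then show ?thesis
      by (auto simp: exp_eq_1 intro!: exI[of _ "- m"])
  qed
  then have "fourier_transform \<mu> ?\<eta> = fourier_transform \<mu> (r *\<^sub>R ?\<eta>)"
    using weight_sum
    by (subst fourier_transform_stationary) (simp add: scaleR_conv_of_real flip: of_real_sum)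
  also have "r *\<^sub>R ?\<eta> = (1 / r) ^ n *\<^sub>R \<xi>"
    using r by simp
  finally show ?case using Suc by simp
qed simp

text \<open>If almost every \<open>x\<close> satisfies \<open>a \<bullet> x = b\<close>, so does its
  image under each map; comparing the two fixes \<open>a \<bullet> t j\<close>. The zero translation
  forces \<open>b = 0\<close>, and then \<open>a\<close> is orthogonal to a spanning set.\<close>

lemma not_supported_in_hyperplane:
  assumes i: "\<And>i. i < N \<Longrightarrow> p i > 0" "i < N" "t i = 0" and r: "r \<noteq> 1"
    and spans: "span (t ` {..<N}) = UNIV" and H: "affine_hyperplane H"
  shows "\<not> supported_in \<mu> H"
proof
  assume supp: "supported_in \<mu> H"
  from H obtain a b where a: "a \<noteq> 0" and H_eq: "H = {x. a \<bullet> x = b}"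
    by (auto simp: affine_hyperplane_def)
  have ae: "AE x in \<mu>. a \<bullet> x = b"
    using supp by (simp add: supported_in_def H_eq)
  have *: "a \<bullet> t j = (1 - r) * b" if "j < N" for j
  proof -
    have "AE x in \<mu>. a \<bullet> (r *\<^sub>R x + t j) = b"
      by (rule AE_stationary[OF ae]) (use that i in auto)
    with ae have "AE x in \<mu>. a \<bullet> t j = (1 - r) * b"
      by eventually_elim (auto simp: inner_add_right algebra_simps)
    then show ?thesis by (simp add: AE_const)
  qed
  from *[OF i(2)] i r have "b = 0" by simp
  with * have "t ` {..<N} \<subseteq> {x. a \<bullet> x = 0}" by auto
  then have "span (t ` {..<N}) \<subseteq> {x. a \<bullet> x = 0}"
    by (rule span_minimal) (rule subspace_hyperplane)
  with spans have "a \<bullet> a = 0" by blast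
  with a show False by simp
qed

end

section \<open>Decay at infinity, continuity of analytic maps, and an integral basis\<close>

lemma not_Rajchman_geometric:
  assumes "\<xi> \<noteq> 0" "\<rho> > 1" "C > 0" and le: "\<And>n. C \<le> norm (fourier_transform \<nu> (\<rho> ^ n *\<^sub>R \<xi>))"
  shows "\<not> Rajchman \<nu>"
proof
  assume "Rajchman \<nu>"
  have "filterlim (\<lambda>n. \<rho> ^ n) at_top sequentially"
    using \<open>\<rho> > 1\<close>
    by (intro filterlim_at_infinity_imp_filterlim_at_top filterlim_realpow_sequentially_gt1) auto
  then have "filterlim (\<lambda>n. \<rho> ^ n * norm \<xi>) at_top sequentially"
    using \<open>\<xi> \<noteq> 0\<close> by (intro filterlim_at_top_mult_tendsto_pos[OF tendsto_const]) auto
  then have "filterlim (\<lambda>n. \<rho> ^ n *\<^sub>R \<xi>) at_infinity sequentially"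
    unfolding filterlim_at_infinity_conv_norm_at_top using \<open>\<rho> > 1\<close> by simp
  with \<open>Rajchman \<nu>\<close> have "(\<lambda>n. fourier_transform \<nu> (\<rho> ^ n *\<^sub>R \<xi>)) \<longlonglongrightarrow> 0"
    unfolding Rajchman_def by (rule filterlim_compose)
  then have "(\<lambda>n. norm (fourier_transform \<nu> (\<rho> ^ n *\<^sub>R \<xi>))) \<longlonglongrightarrow> 0"
    by (rule tendsto_norm_zero)
  then have "C \<le> 0"
    by (rule LIMSEQ_le_const) (use le in auto)
  with \<open>C > 0\<close> show False by simp
qed

text \<open>Continuity makes \<open>f\<close> Borel measurable, so that integrals against the
  push-forward can be computed on the source.\<close>

lemma real_analytic_continuous_on:
  assumes "real_analytic f"
  shows "continuous_on UNIV f"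
proof (rule continuous_at_imp_continuous_on, intro ballI)
  fix x0
  from assms obtain e c where e: "e > 0" and "\<forall>x\<in>ball x0 e.
      ((\<lambda>\<alpha>. (\<Prod>j\<in>UNIV. (x $ j - x0 $ j) ^ \<alpha> j) *\<^sub>R c \<alpha>) has_sum f x) UNIV"
    unfolding real_analytic_def by (elim allE[of _ x0] exE conjE)
  then have f: "((\<lambda>\<alpha>. (\<Prod>j\<in>UNIV. (x $ j - x0 $ j) ^ \<alpha> j) *\<^sub>R c \<alpha>) has_sum f x) UNIV"
    if "x \<in> ball x0 e" for x
    using that by blast
  \<comment> \<open>Convergence at the corner \<open>y\<close> of a cube dominates the series on the whole cube.\<close>
  define \<delta> where "\<delta> = e / (norm (1 :: real ^ 'a) + 1)"
  have n: "norm (1 :: real ^ 'a) + 1 > 0" by (simp add: add_nonneg_pos)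
  with e have \<delta>: "\<delta> > 0" by (simp add: \<delta>_def)
  define y where "y = x0 + \<delta> *\<^sub>R 1"
  have "y \<in> ball x0 e"
    using e n \<delta> by (simp add: y_def dist_norm) (simp add: \<delta>_def field_simps)
  let ?B = "ball x0 (min \<delta> e)"
  have "continuous_on ?B (\<lambda>x. f x $ m)" for m
  proof -
    have sum: "((\<lambda>\<alpha>. (\<Prod>j\<in>UNIV. (x $ j - x0 $ j) ^ \<alpha> j) * c \<alpha> $ m) has_sum f x $ m) UNIV"
      if "x \<in> ball x0 e" for x
      using has_sum_bounded_linear[OF bounded_linear_vec_nth f[OF that], of m]
      by (simp add: o_def)
    have "(\<lambda>\<alpha>. (\<Prod>j\<in>UNIV. \<delta> ^ \<alpha> j) * c \<alpha> $ m) summable_on UNIV"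
      using has_sum_imp_summable[OF sum[OF \<open>y \<in> ball x0 e\<close>]] by (simp add: y_def)
    \<comment> \<open>Passing to real components makes unordered summability absolute, which
      provides the majorant for the M-test.\<close>
    then have M: "(\<lambda>\<alpha>. norm ((\<Prod>j\<in>UNIV. \<delta> ^ \<alpha> j) * c \<alpha> $ m)) summable_on UNIV"
      by (rule iffD1[OF summable_on_iff_abs_summable_on_real])
    have "uniform_limit ?B (\<lambda>X x. \<Sum>\<alpha>\<in>X. (\<Prod>j\<in>UNIV. (x $ j - x0 $ j) ^ \<alpha> j) * c \<alpha> $ m)
        (\<lambda>x. f x $ m) (finite_subsets_at_top UNIV)"
    proof (rule Weierstrass_m_test_general'[OF _ _ M])
      fix \<alpha> :: "'a \<Rightarrow> nat" and x assume x: "x \<in> ?B"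
      have "\<bar>x $ j - x0 $ j\<bar> \<le> \<delta>" for j
        using component_le_norm_cart[of "x - x0" j] x by (simp add: dist_norm norm_minus_commute)
      then have "(\<Prod>j\<in>UNIV. \<bar>x $ j - x0 $ j\<bar> ^ \<alpha> j) \<le> (\<Prod>j\<in>UNIV. \<delta> ^ \<alpha> j)"
        by (intro prod_mono conjI power_mono) auto
      then show "norm ((\<Prod>j\<in>UNIV. (x $ j - x0 $ j) ^ \<alpha> j) * c \<alpha> $ m)
          \<le> norm ((\<Prod>j\<in>UNIV. \<delta> ^ \<alpha> j) * c \<alpha> $ m)"
        using \<delta> by (simp add: abs_mult abs_prod power_abs mult_right_mono)
    qed (use sum in auto)
    moreover have "\<forall>X. continuous_on ?B (\<lambda>x. \<Sum>\<alpha>\<in>X. (\<Prod>j\<in>UNIV. (x $ j - x0 $ j) ^ \<alpha> j) * c \<alpha> $ m)"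
      by (intro allI continuous_intros)
    ultimately show ?thesis
      by (intro uniform_limit_theorem[OF always_eventually _ finite_subsets_at_top_neq_bot])
  qed
  then have "continuous_on ?B (\<lambda>x. \<chi> m. f x $ m)"
    by (rule continuous_on_vec_lambda)
  then have "continuous_on ?B f"
    unfolding vec_nth_inverse .
  moreover have "x0 \<in> ?B"
    using \<delta> e by simp
  ultimately show "isCont f x0"
    using continuous_on_eq_continuous_at[OF open_ball] by blast
qed

text \<open>Frequencies along \<open>b\<close> see \<open>f\<close> only through an affine function,
  whose constant term contributes a unimodular factor.\<close>

lemma fourier_transform_distr_affine:
  assumes [measurable]: "f \<in> borel_measurable \<mu>" and f: "\<And>x. b \<bullet> f x = a \<bullet> x + c"
  shows "norm (fourier_transform (distr \<mu> borel f) (s *\<^sub>R b)) = norm (fourier_transform \<mu> (s *\<^sub>R a))"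
proof -
  let ?e = "\<lambda>y. exp (- 2 * pi * \<i> * complex_of_real y)"
  have "?e ((s *\<^sub>R b) \<bullet> f x) = ?e (s * c) * ?e ((s *\<^sub>R a) \<bullet> x)" for x
    unfolding exp_add[symmetric] by (simp add: f ring_distribs add.commute)
  moreover have "fourier_transform (distr \<mu> borel f) (s *\<^sub>R b) = (\<integral>x. ?e ((s *\<^sub>R b) \<bullet> f x) \<partial>\<mu>)"
    unfolding fourier_transform_def by (subst integral_distr) auto
  ultimately have "fourier_transform (distr \<mu> borel f) (s *\<^sub>R b) = ?e (s * c) * fourier_transform \<mu> (s *\<^sub>R a)"
    by (simp only: fourier_transform_def integral_mult_right_zero)
  then show ?thesis
    by (simp add: norm_mult)
qed

lemma exists_basis_integral:
  fixes a :: "real ^ 'k"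
  assumes "a \<noteq> 0"
  shows "\<exists>v :: 'k \<Rightarrow> real ^ 'k. (\<forall>j. a \<bullet> v j \<in> \<int>) \<and> (\<forall>j. v j \<noteq> 0) \<and> span (range v) = UNIV"
proof -
  from assms obtain l where l: "a $ l \<noteq> 0" by (auto simp: vec_eq_iff)
  \<comment> \<open>\<open>v l\<close> pairs to 1 with \<open>a\<close>; subtracting
    \<open>a $ j\<close> times it moves every other axis vector into the kernel of
    \<open>a\<close>.\<close>
  define v where "v j = (if j = l then axis l (1 / a $ l) else axis j 1 - (a $ j) *\<^sub>R axis l (1 / a $ l))" for j
  have a: "a \<bullet> v j = (if j = l then 1 else 0)" for j
    using l by (simp add: v_def inner_diff_right inner_axis)
  have ne: "v j \<noteq> 0" for j
  proof -
    have "v j $ j \<noteq> 0" using l by (simp add: v_def axis_def)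
    then show ?thesis by auto
  qed
  have l_in: "axis l (1 / a $ l) \<in> span (range v)"
    using span_base[of "v l" "range v"] by (simp add: v_def)
  have ax: "axis j 1 \<in> span (range v)" for j
  proof (cases "j = l")
    case True
    have "a $ l *\<^sub>R axis l (1 / a $ l) \<in> span (range v)" using l_in by (rule span_scale)
    also have "a $ l *\<^sub>R axis l (1 / a $ l) = axis l 1" using l by (simp add: vec_eq_iff axis_def)
    finally show ?thesis using True by simp
  next
    case False
    have "v j + (a $ j) *\<^sub>R axis l (1 / a $ l) \<in> span (range v)"
      by (intro span_add span_scale l_in span_base) auto
    then show ?thesis using False by (simp add: v_def)
  qed
  have "x \<in> span (range v)" for x
  proof -
    have "(\<Sum>j\<in>UNIV. x $ j *\<^sub>R axis j 1) \<in> span (range v)"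
      by (intro span_sum span_scale ax)
    then show ?thesis by (simp add: basis_expansion flip: scalar_mult_eq_scaleR)
  qed
  then show ?thesis using a ne by (intro exI[of _ v]) auto
qed

section \<open>Choice of the measure for a given partially linear map\<close>

theorem proposition1p4:
  fixes f :: "real ^ 'k \<Rightarrow> real ^ 'd"
  assumes "real_analytic f" and "partially_linear f"
  shows "\<exists>\<mu> :: (real ^ 'k) measure.
           self_similar_measure \<mu> \<and>
           (\<forall>H. affine_hyperplane H \<longrightarrow> \<not> supported_in \<mu> H) \<and>
           \<not> Rajchman \<mu> \<and>
           \<not> Rajchman (distr \<mu> borel f)"
proof -
  from assms(2) obtain b' :: "'d \<Rightarrow> real" and a c i where
    "b' i \<noteq> 0" and lin: "\<And>x. (\<Sum>i\<in>UNIV. b' i * f x $ i) = a \<bullet> x + c"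
    unfolding partially_linear_def by blast
  define b :: "real ^ 'd" where "b = (\<chi> i. b' i)"
  have b: "b \<noteq> 0" using \<open>b' i \<noteq> 0\<close> by (auto simp: b_def vec_eq_iff)
  have lin: "b \<bullet> f x = a \<bullet> x + c" for x
    using lin by (simp add: b_def inner_vec_def)
  \<comment> \<open>When \<open>a = 0\<close> an arbitrary nonzero direction replaces it, since
    \<mu> itself must fail to decay along some line.\<close>
  obtain a' where a': "a' \<noteq> 0" "a = 0 \<or> a = a'"
    by (metis axis_eq_0_iff zero_neq_one)
  obtain v :: "'k \<Rightarrow> real ^ 'k" where
    v: "\<And>j. a' \<bullet> v j \<in> \<int>" "\<And>j. v j \<noteq> 0" "span (range v) = UNIV"
    using exists_basis_integral[OF a'(1)] by blast
  define K where "K = CARD('k)"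
  have K: "K > 0" by (simp add: K_def)
  obtain h where h: "bij_betw h {..<K} (UNIV :: 'k set)"
    unfolding K_def by (metis ex_bij_betw_nat_finite finite lessThan_atLeast0)
  \<comment> \<open>Index 0 carries the zero translation, and indices 1 to \<open>K\<close> carry
    the basis.\<close>
  define N where "N = Suc K"
  define t where "t i = (case i of 0 \<Rightarrow> 0 | Suc j \<Rightarrow> v (h j))" for i
  define p :: "nat \<Rightarrow> real" where "p i = (if i = 0 then 2 / 3 else 1 / (3 * K))" for i
  have p_pos: "0 < p i" for i using K by (simp add: p_def)
  have p_less: "p i < 1" for i using K by (simp add: p_def field_simps)
  have p_sum: "(\<Sum>i<N. p i) = 1"
    unfolding N_def sum.lessThan_Suc_shift using K by (simp add: p_def)
  have "v j \<in> t ` {..<N}" for j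
  proof -
    from h obtain m where "m < K" "h m = j" unfolding bij_betw_def by (metis UNIV_I imageE lessThan_iff)
    then show ?thesis by (intro image_eqI[of _ _ "Suc m"]) (auto simp: t_def N_def)
  qed
  then have spans: "span (t ` {..<N}) = UNIV"
    using v(3) span_mono[of "range v" "t ` {..<N}"] by blast
  obtain \<mu> where "homothetic_measure \<mu> N (1 / 3) t p"
    using homothetic_measure_exists[of "1 / 3" N p t] p_sum p_pos by (auto simp: less_imp_le)
  then interpret homothetic_measure \<mu> N "1 / 3" t p .
  \<comment> \<open>The case \<open>\<xi> = 0\<close> covers \<open>a = 0\<close>, where the
    frequency seen by \<mu> stays at 0.\<close>
  have lattice: "\<xi> \<bullet> t i \<in> \<int>" if "\<xi> = 0 \<or> \<xi> = a'" for i \<xi>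
    using that v by (auto simp: t_def split: nat.split)
  have nonzero: "fourier_transform \<mu> \<xi> \<noteq> 0" for \<xi>
    by (rule fourier_transform_nonzero[of 0]) (auto simp: N_def t_def p_def)
  have const: "fourier_transform \<mu> (3 ^ n *\<^sub>R \<xi>) = fourier_transform \<mu> \<xi>" if "\<xi> = 0 \<or> \<xi> = a'" for \<xi> n
    using fourier_transform_lattice[of \<xi> n] lattice[OF that] by simp
  have sim: "similarity_map (1 / 3) (mat 1) s x = (1 / 3) *\<^sub>R x + s" for s x :: "real ^ 'k"
    by (simp add: similarity_map_def)
  \<comment> \<open>Map 0 fixes only the origin, which map 1 moves by the nonzero vector
    \<open>v (h 0)\<close>.\<close>
  have no_fix: "\<not> (\<exists>x. \<forall>i<N. similarity_map (1 / 3) (mat 1) (t i) x = x)"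
  proof
    assume "\<exists>x. \<forall>i<N. similarity_map (1 / 3) (mat 1) (t i) x = x"
    then obtain x where x: "\<And>i. i < N \<Longrightarrow> (1 / 3) *\<^sub>R x + t i = x" by (auto simp: sim)
    have "(1 / 3) *\<^sub>R x = 1 *\<^sub>R x" using x[of 0] by (simp add: N_def t_def)
    then have "x = 0" unfolding scaleR_cancel_right by simp
    with x[of 1] K v(2) show False by (simp add: N_def t_def)
  qed
  have "self_similar_measure \<mu>"
    unfolding self_similar_measure_def
    using K p_pos p_less p_sum no_fix measure_stationary
    by (intro conjI prob_space_axioms sets_eq exI[of _ N] exI[of _ "\<lambda>_. 1 / 3"]
        exI[of _ "\<lambda>_. mat 1"] exI[of _ t] exI[of _ p])
      (auto simp: N_def sim[abs_def] orthogonal_matrix_id)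
  moreover have "\<not> supported_in \<mu> H" if "affine_hyperplane H" for H
    by (rule not_supported_in_hyperplane[of 0]) (use p_pos spans that in \<open>auto simp: N_def t_def\<close>)
  moreover have "\<not> Rajchman \<mu>"
    by (rule not_Rajchman_geometric[of a' 3 "norm (fourier_transform \<mu> a')"])
      (use a' nonzero const in auto)
  moreover have "\<not> Rajchman (distr \<mu> borel f)"
  proof (rule not_Rajchman_geometric[of b 3 "norm (fourier_transform \<mu> a)"])
    have [measurable]: "f \<in> borel_measurable \<mu>"
      using borel_measurable_continuous_onI[OF real_analytic_continuous_on[OF assms(1)]]
      by (simp cong: measurable_cong_sets add: sets_eq)
    show "norm (fourier_transform \<mu> a) \<le> norm (fourier_transform (distr \<mu> borel f) (3 ^ n *\<^sub>R b))" for n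
      using a' by (subst fourier_transform_distr_affine[OF _ lin]) (auto simp: const)
  qed (use b nonzero in auto)
  ultimately show ?thesis by blast
qed

end
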